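(* Let $G$ be a convex set endowed with a metric $d\colon G\times G\to[0,\infty)$ such that, for every $x,y\in G$ and $\lambda\in(0,1)$, there exists some $\lambda(x,y)\in G$ with $d(x,\lambda(x,y))=\lambda d(x,y)$ and $d(\lambda(x,y),y)=(1-\lambda)d(x,y)$. Let $S=(S(t))_{t\ge0}$ be the uncertain shift semigroup on $\mathrm{BUC}=\mathrm{BUC}(G)$, defined by \[\big(S(t)f\big)(x):=\sup_{d(x,y)\le t}f(y)\quad\text{for all }f\in\mathrm{BUC},\ x\in G,\ t\ge0.\] Then $S$ is a sublinear monotone $C_0$-semigroup on $\mathrm{BUC}$. Moreover, $D_L=D_L^s=\mathrm{Lip}_b$, where $\mathrm{Lip}_b=\mathrm{Lip}_b(G)$ is the space of all bounded Lipschitz continuous functions $G\to\mathbb{R}$.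
   Context: $\mathrm{BUC}(G)$ is the space of all bounded uniformly continuous functions $f\colon G\to\mathbb{R}$ with the norm $\|f\|_\infty:=\sup_{x\in G}|f(x)|$ and the pointwise order. An operator $T\colon\mathrm{BUC}\to\mathrm{BUC}$ is sublinear if it is convex ($T(\lambda f+(1-\lambda)g)\le\lambda Tf+(1-\lambda)Tg$ for $\lambda\in[0,1]$) and positive homogeneous ($T(\lambda f)=\lambda Tf$ for $\lambda>0$); monotone if $f\le g$ implies $Tf\le Tg$; bounded if $\sup_{\|f\|_\infty\le r}\|Tf\|_\infty<\infty$ for all $r>0$. A $C_0$-semigroup on $\mathrm{BUC}$ is a family $S=(S(t))_{t\ge0}$ of bounded operators $\mathrm{BUC}\to\mathrm{BUC}$ with $S(0)f=f$, $S(t+s)f=S(t)S(s)f$ for all $s,t\ge0$, and $\|S(t)f-f\|_\infty\to0$ as $t\downarrow0$, for all $f\in\mathrm{BUC}$; it is sublinear (monotone) if each $S(t)$ is. The Lipschitz set is $D_L:=\{f\in\mathrm{BUC}\colon\sup_{h\in(0,h_0]}\|\frac{S(h)f-f}{h}\|_\infty<\infty\text{ for some }h_0>0\}$, and the symmetric Lipschitz set is $D_L^s:=\{f\in\mathrm{BUC}\colon f,-f\in D_L\}$. *)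

theory Defs
  imports "HOL-Analysis.Analysis"
begin

text \<open>
  The space \<open>G\<close> is an abstract metric space of type \<open>'a metric\<close>, with points \<open>mspace G\<close> and
  distance \<open>mdist G\<close>. Functions \<open>G \<rightarrow> \<real>\<close> are modelled as functions that are
  \<open>extensional\<close> on \<open>mspace G\<close>, so that HOL equality of two of them is equality on \<open>G\<close>;
  pointwise operations are therefore restricted to \<open>mspace G\<close>.
\<close>

definition BUC :: "'a metric \<Rightarrow> ('a \<Rightarrow> real) set" where
  "BUC G = {f \<in> extensional (mspace G).
     bounded (f ` mspace G) \<and> uniformly_continuous_map G euclidean_metric f}"

definition Lip_b :: "'a metric \<Rightarrow> ('a \<Rightarrow> real) set" where
  "Lip_b G = {f \<in> extensional (mspace G).
     bounded (f ` mspace G) \<and> Lipschitz_continuous_map G euclidean_metric f}"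

text \<open>
  Suprema of norms are taken in \<open>[0,\<infinity>]\<close>, so that conditions of the form \<open>sup \<dots> < \<infinity>\<close> can be
  stated literally. In particular the norm is \<open>0\<close> when \<open>G\<close> is empty.
\<close>

definition sup_norm :: "'a metric \<Rightarrow> ('a \<Rightarrow> real) \<Rightarrow> ennreal" where
  "sup_norm G f = (SUP x\<in>mspace G. ennreal \<bar>f x\<bar>)"

definition convex_operator :: "'a metric \<Rightarrow> (('a \<Rightarrow> real) \<Rightarrow> ('a \<Rightarrow> real)) \<Rightarrow> bool" where
  "convex_operator G T \<longleftrightarrow>
     (\<forall>f\<in>BUC G. \<forall>g\<in>BUC G. \<forall>c\<in>{0..1}. \<forall>x\<in>mspace G.
        T (\<lambda>y\<in>mspace G. c * f y + (1 - c) * g y) x \<le> c * T f x + (1 - c) * T g x)"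

definition pos_homogeneous_operator :: "'a metric \<Rightarrow> (('a \<Rightarrow> real) \<Rightarrow> ('a \<Rightarrow> real)) \<Rightarrow> bool" where
  "pos_homogeneous_operator G T \<longleftrightarrow>
     (\<forall>f\<in>BUC G. \<forall>c>0. T (\<lambda>x\<in>mspace G. c * f x) = (\<lambda>x\<in>mspace G. c * T f x))"

definition sublinear_operator :: "'a metric \<Rightarrow> (('a \<Rightarrow> real) \<Rightarrow> ('a \<Rightarrow> real)) \<Rightarrow> bool" where
  "sublinear_operator G T \<longleftrightarrow> convex_operator G T \<and> pos_homogeneous_operator G T"

definition monotone_operator :: "'a metric \<Rightarrow> (('a \<Rightarrow> real) \<Rightarrow> ('a \<Rightarrow> real)) \<Rightarrow> bool" where
  "monotone_operator G T \<longleftrightarrow>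
     (\<forall>f\<in>BUC G. \<forall>g\<in>BUC G.
        (\<forall>x\<in>mspace G. f x \<le> g x) \<longrightarrow> (\<forall>x\<in>mspace G. T f x \<le> T g x))"

definition bounded_operator :: "'a metric \<Rightarrow> (('a \<Rightarrow> real) \<Rightarrow> ('a \<Rightarrow> real)) \<Rightarrow> bool" where
  "bounded_operator G T \<longleftrightarrow>
     T \<in> BUC G \<rightarrow> BUC G \<and>
     (\<forall>r>0. (SUP f\<in>{f \<in> BUC G. sup_norm G f \<le> ennreal r}. sup_norm G (T f)) < \<infinity>)"

definition C0_semigroup :: "'a metric \<Rightarrow> (real \<Rightarrow> ('a \<Rightarrow> real) \<Rightarrow> ('a \<Rightarrow> real)) \<Rightarrow> bool" where
  "C0_semigroup G S \<longleftrightarrow>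
     (\<forall>t\<ge>0. bounded_operator G (S t)) \<and>
     (\<forall>f\<in>BUC G. S 0 f = f) \<and>
     (\<forall>f\<in>BUC G. \<forall>s\<ge>0. \<forall>t\<ge>0. S (t + s) f = S t (S s f)) \<and>
     (\<forall>f\<in>BUC G. ((\<lambda>t. sup_norm G (\<lambda>x. S t f x - f x)) \<longlongrightarrow> 0) (at_right 0))"

definition sublinear_semigroup :: "'a metric \<Rightarrow> (real \<Rightarrow> ('a \<Rightarrow> real) \<Rightarrow> ('a \<Rightarrow> real)) \<Rightarrow> bool" where
  "sublinear_semigroup G S \<longleftrightarrow> (\<forall>t\<ge>0. sublinear_operator G (S t))"

definition monotone_semigroup :: "'a metric \<Rightarrow> (real \<Rightarrow> ('a \<Rightarrow> real) \<Rightarrow> ('a \<Rightarrow> real)) \<Rightarrow> bool" where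
  "monotone_semigroup G S \<longleftrightarrow> (\<forall>t\<ge>0. monotone_operator G (S t))"

definition Lipschitz_set ::
  "'a metric \<Rightarrow> (real \<Rightarrow> ('a \<Rightarrow> real) \<Rightarrow> ('a \<Rightarrow> real)) \<Rightarrow> ('a \<Rightarrow> real) set" where
  "Lipschitz_set G S =
     {f \<in> BUC G. \<exists>h\<^sub>0>0. (SUP h\<in>{0<..h\<^sub>0}. sup_norm G (\<lambda>x. (S h f x - f x) / h)) < \<infinity>}"

definition symmetric_Lipschitz_set ::
  "'a metric \<Rightarrow> (real \<Rightarrow> ('a \<Rightarrow> real) \<Rightarrow> ('a \<Rightarrow> real)) \<Rightarrow> ('a \<Rightarrow> real) set" where
  "symmetric_Lipschitz_set G S =
     {f \<in> BUC G. f \<in> Lipschitz_set G S \<and> (\<lambda>x\<in>mspace G. - f x) \<in> Lipschitz_set G S}"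

definition uncertain_shift :: "'a metric \<Rightarrow> real \<Rightarrow> ('a \<Rightarrow> real) \<Rightarrow> ('a \<Rightarrow> real)" where
  "uncertain_shift G t f =
     (\<lambda>x\<in>mspace G. SUP y\<in>{y \<in> mspace G. mdist G x y \<le> t}. f y)"

end

theory Submission imports Defs begin

text \<open>
  The intermediate-point property of \<open>G\<close> splits every pair of points at distance at most \<open>t + s\<close>
  by a point at distance at most \<open>t\<close> from the first and at most \<open>s\<close> from the second. Hence the
  \<open>t\<close>-balls around points of the \<open>s\<close>-ball fill out the \<open>(t + s)\<close>-ball, which is the semigroup law,
  and \<open>S(t)\<close> preserves moduli of continuity. If \<open>S(h)f - f \<le> C h\<close> for small \<open>h\<close>, then taking
  \<open>h = d(x,y)\<close> gives \<open>\<bar>f(x) - f(y)\<bar> \<le> C d(x,y)\<close> for close points, and boundedness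
  of \<open>f\<close> takes care of the others.
\<close>

section \<open>Bounded uniformly continuous and Lipschitz functions in terms of real
  estimates\<close>

lemma mdist_self [simp]: "x \<in> mspace m \<Longrightarrow> mdist m x x = 0"
  by simp

lemma BUC_iff:
  "f \<in> BUC G \<longleftrightarrow> f \<in> extensional (mspace G) \<and> (\<exists>M. \<forall>x\<in>mspace G. \<bar>f x\<bar> \<le> M) \<and>
     (\<forall>e>0. \<exists>d>0. \<forall>x\<in>mspace G. \<forall>y\<in>mspace G. mdist G x y < d \<longrightarrow> \<bar>f x - f y\<bar> < e)"
proof -
  have "uniformly_continuous_map G euclidean_metric f \<longleftrightarrow>
     (\<forall>e>0. \<exists>d>0. \<forall>x\<in>mspace G. \<forall>y\<in>mspace G. mdist G x y < d \<longrightarrow> \<bar>f x - f y\<bar> < e)"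
    unfolding uniformly_continuous_map_def
    by (simp add: dist_real_def mdist_commute abs_minus_commute)
  then show ?thesis
    by (simp add: BUC_def bounded_iff)
qed

lemma Lip_b_iff:
  "f \<in> Lip_b G \<longleftrightarrow> f \<in> extensional (mspace G) \<and> (\<exists>M. \<forall>x\<in>mspace G. \<bar>f x\<bar> \<le> M) \<and>
     (\<exists>B>0. \<forall>x\<in>mspace G. \<forall>y\<in>mspace G. \<bar>f x - f y\<bar> \<le> B * mdist G x y)"
  unfolding Lip_b_def Lipschitz_continuous_map_pos bounded_iff
  by (auto simp: dist_real_def)

lemma Lip_b_subset_BUC: "Lip_b G \<subseteq> BUC G"
  using Lipschitz_imp_uniformly_continuous_map by (auto simp: Lip_b_def BUC_def)

lemma BUC_bound:
  assumes "f \<in> BUC G"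
  obtains M where "M \<ge> 0" "\<And>x. x \<in> mspace G \<Longrightarrow> \<bar>f x\<bar> \<le> M"
proof -
  obtain M where "\<forall>x\<in>mspace G. \<bar>f x\<bar> \<le> M"
    using assms by (auto simp: BUC_iff)
  then show ?thesis
    \<comment> \<open>On an empty space any \<open>M\<close> is a bound, even a negative
      one.\<close>
    by (intro that[of "max 0 M"]) (auto intro: max.coboundedI2)
qed

lemma BUC_scale:
  assumes f: "f \<in> BUC G"
  shows "(\<lambda>x\<in>mspace G. c * f x) \<in> BUC G"
proof -
  obtain M where M: "\<And>x. x \<in> mspace G \<Longrightarrow> \<bar>f x\<bar> \<le> M"
    using BUC_bound[OF f] by metis
  have "\<exists>d>0. \<forall>x\<in>mspace G. \<forall>y\<in>mspace G. mdist G x y < d \<longrightarrow> \<bar>c * f x - c * f y\<bar> < e"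
    if "e > 0" for e
  proof -
    \<comment> \<open>Dividing by \<open>\<bar>c\<bar> + 1\<close> rather than
      \<open>\<bar>c\<bar>\<close> also covers \<open>c = 0\<close>.\<close>
    have "e / (\<bar>c\<bar> + 1) > 0"
      using that by simp
    then obtain d where "d > 0"
      and d: "\<forall>x\<in>mspace G. \<forall>y\<in>mspace G. mdist G x y < d \<longrightarrow> \<bar>f x - f y\<bar> < e / (\<bar>c\<bar> + 1)"
      using f by (auto simp only: BUC_iff)
    have "\<bar>c * f x - c * f y\<bar> < e" if "x \<in> mspace G" "y \<in> mspace G" "mdist G x y < d" for x y
    proof -
      have "\<bar>c * f x - c * f y\<bar> = \<bar>c\<bar> * \<bar>f x - f y\<bar>"
        by (simp flip: abs_mult right_diff_distrib)
      also have "\<dots> \<le> (\<bar>c\<bar> + 1) * \<bar>f x - f y\<bar>"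
        by (simp add: mult_right_mono)
      also have "\<dots> < e"
        using d that by (auto simp: field_simps)
      finally show ?thesis .
    qed
    then show ?thesis
      using \<open>d > 0\<close> by blast
  qed
  moreover have "\<forall>x\<in>mspace G. \<bar>c * f x\<bar> \<le> \<bar>c\<bar> * M"
    using M by (simp add: abs_mult mult_left_mono)
  ultimately show ?thesis
    by (auto simp: BUC_iff)
qed

lemma Lip_b_uminus: "f \<in> Lip_b G \<Longrightarrow> (\<lambda>x\<in>mspace G. - f x) \<in> Lip_b G"
  by (fastforce simp: Lip_b_iff abs_minus_commute)

section \<open>Norm bounds in the extended reals as real bounds\<close>

lemma sup_norm_le_iff:
  "c \<ge> 0 \<Longrightarrow> sup_norm G f \<le> ennreal c \<longleftrightarrow> (\<forall>x\<in>mspace G. \<bar>f x\<bar> \<le> c)"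
  by (simp add: sup_norm_def SUP_le_iff)

text \<open>A finite value in \<open>ennreal\<close> is a real \<open>C \<ge> 0\<close>, and this is
  then a common bound. Both the boundedness of an operator and the condition defining
  \<open>Lipschitz_set\<close> have this form.\<close>

lemma SUP_sup_norm_finite_iff:
  "(SUP i\<in>I. sup_norm G (F i)) < \<infinity> \<longleftrightarrow> (\<exists>C\<ge>0. \<forall>i\<in>I. \<forall>x\<in>mspace G. \<bar>F i x\<bar> \<le> C)"
proof
  assume "(SUP i\<in>I. sup_norm G (F i)) < \<infinity>"
  then obtain C where "C \<ge> 0" and C: "(SUP i\<in>I. sup_norm G (F i)) = ennreal C"
    by (metis infinity_ennreal_def less_top_ennreal)
  from C have "\<forall>i\<in>I. sup_norm G (F i) \<le> ennreal C"
    by (metis SUP_upper)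
  with \<open>C \<ge> 0\<close> show "\<exists>C\<ge>0. \<forall>i\<in>I. \<forall>x\<in>mspace G. \<bar>F i x\<bar> \<le> C"
    using sup_norm_le_iff by blast
next
  assume "\<exists>C\<ge>0. \<forall>i\<in>I. \<forall>x\<in>mspace G. \<bar>F i x\<bar> \<le> C"
  then obtain C where "C \<ge> 0" "\<forall>i\<in>I. \<forall>x\<in>mspace G. \<bar>F i x\<bar> \<le> C"
    by blast
  then have "(SUP i\<in>I. sup_norm G (F i)) \<le> ennreal C"
    by (auto simp: SUP_le_iff sup_norm_le_iff)
  then show "(SUP i\<in>I. sup_norm G (F i)) < \<infinity>"
    by (simp add: le_less_trans[OF _ ennreal_less_top])
qed

section \<open>Order properties of the supremum over a closed ball\<close>

text \<open>A real \<open>SUP\<close> is a least upper bound only over a nonempty set with values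
  bounded above: \<open>f\<close> is bounded, and the ball contains its centre because
  \<open>t \<ge> 0\<close>. Most later facts about the shift are obtained by comparing upper bounds
  through this equivalence.\<close>

lemma uncertain_shift_le_iff:
  assumes f: "f \<in> BUC G" and x: "x \<in> mspace G" and t: "t \<ge> 0"
  shows "uncertain_shift G t f x \<le> a \<longleftrightarrow> (\<forall>y\<in>mspace G. mdist G x y \<le> t \<longrightarrow> f y \<le> a)"
proof -
  obtain M where "\<And>x. x \<in> mspace G \<Longrightarrow> \<bar>f x\<bar> \<le> M"
    using BUC_bound[OF f] by metis
  then have "bdd_above (f ` {y \<in> mspace G. mdist G x y \<le> t})"
    by (intro bdd_aboveI2[of _ _ M]) force
  moreover have "{y \<in> mspace G. mdist G x y \<le> t} \<noteq> {}"
    using x t by force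
  ultimately show ?thesis
    using x by (auto simp: uncertain_shift_def cSUP_le_iff)
qed

lemma uncertain_shift_upper:
  assumes "f \<in> BUC G" "x \<in> mspace G" "y \<in> mspace G" "mdist G x y \<le> t"
  shows "f y \<le> uncertain_shift G t f x"
proof -
  have "t \<ge> 0"
    using assms(4) mdist_nonneg[of G x y] by linarith
  then show ?thesis
    using uncertain_shift_le_iff[of f G x t "uncertain_shift G t f x"] assms by simp
qed

text \<open>The upper bound passes to the supremum. The lower one holds because \<open>x\<close>
  lies in its own ball, so the supremum is at least \<open>f x\<close>.\<close>

lemma uncertain_shift_abs_le:
  assumes f: "f \<in> BUC G" and x: "x \<in> mspace G" and t: "t \<ge> 0"
    and M: "\<forall>y\<in>mspace G. \<bar>f y\<bar> \<le> M"
  shows "\<bar>uncertain_shift G t f x\<bar> \<le> M"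
proof -
  have "uncertain_shift G t f x \<le> M"
    using M by (auto simp: uncertain_shift_le_iff[OF f x t] abs_le_iff)
  moreover have "f x \<le> uncertain_shift G t f x"
    using uncertain_shift_upper[OF f x x] x t by simp
  moreover have "- M \<le> f x"
    using M x by force
  ultimately show ?thesis
    by linarith
qed

text \<open>The shift never decreases \<open>f\<close>, so the absolute value carries only a
  one-sided condition.\<close>

lemma uncertain_shift_diff_le_iff:
  assumes f: "f \<in> BUC G" and x: "x \<in> mspace G" and t: "t \<ge> 0"
  shows "\<bar>uncertain_shift G t f x - f x\<bar> \<le> a \<longleftrightarrow>
    (\<forall>y\<in>mspace G. mdist G x y \<le> t \<longrightarrow> f y - f x \<le> a)"
proof -
  have "f x \<le> uncertain_shift G t f x"
    using uncertain_shift_upper[OF f x x] x t by simp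
  then have "\<bar>uncertain_shift G t f x - f x\<bar> \<le> a \<longleftrightarrow> uncertain_shift G t f x \<le> f x + a"
    by linarith
  also have "\<dots> \<longleftrightarrow> (\<forall>y\<in>mspace G. mdist G x y \<le> t \<longrightarrow> f y - f x \<le> a)"
    by (simp add: uncertain_shift_le_iff[OF f x t] algebra_simps)
  finally show ?thesis .
qed

section \<open>The Lipschitz set and the symmetric Lipschitz set\<close>

lemma mem_Lipschitz_set_uncertain_shift_iff:
  "f \<in> Lipschitz_set G (uncertain_shift G) \<longleftrightarrow> f \<in> BUC G \<and>
     (\<exists>h\<^sub>0>0. \<exists>C\<ge>0. \<forall>h\<in>{0<..h\<^sub>0}. \<forall>x\<in>mspace G. \<forall>y\<in>mspace G. mdist G x y \<le> h \<longrightarrow> f y - f x \<le> C * h)"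
proof -
  have "\<bar>(uncertain_shift G h f x - f x) / h\<bar> \<le> C \<longleftrightarrow>
      (\<forall>y\<in>mspace G. mdist G x y \<le> h \<longrightarrow> f y - f x \<le> C * h)"
    if "f \<in> BUC G" "h > 0" "x \<in> mspace G" for h x C
    using uncertain_shift_diff_le_iff[of f G x h "C * h"] that by (simp add: abs_divide divide_le_eq)
  then show ?thesis
    unfolding Lipschitz_set_def SUP_sup_norm_finite_iff mem_Collect_eq
    by (intro conj_cong refl ex_cong1 ball_cong) auto
qed

text \<open>Membership on the left bounds \<open>f y - f x\<close> only from above, but for all
  pairs; exchanging \<open>x\<close> and \<open>y\<close> yields the two-sided Lipschitz
  estimate.\<close>

lemma Lipschitz_set_uncertain_shift: "Lipschitz_set G (uncertain_shift G) = Lip_b G"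
proof (intro set_eqI iffI)
  fix f assume "f \<in> Lipschitz_set G (uncertain_shift G)"
  then obtain r C where f: "f \<in> BUC G" and r: "r > 0" and "C \<ge> 0"
    and C: "\<And>h x y. \<lbrakk>0 < h; h \<le> r; x \<in> mspace G; y \<in> mspace G; mdist G x y \<le> h\<rbrakk> \<Longrightarrow> f y - f x \<le> C * h"
    unfolding mem_Lipschitz_set_uncertain_shift_iff by force
  obtain M where "M \<ge> 0" and M: "\<And>x. x \<in> mspace G \<Longrightarrow> \<bar>f x\<bar> \<le> M"
    using BUC_bound[OF f] by metis
  \<comment> \<open>\<open>C\<close> serves pairs at distance at most \<open>r\<close>. Values at
    farther points differ by at most \<open>2 * M\<close>, which is \<open>(2 * M / r) * r\<close>.
    The summand \<open>1\<close> makes \<open>B\<close> positive, as \<open>Lip_b_iff\<close>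
    demands.\<close>
  define B where "B = C + 2 * M / r + 1"
  have "B > 0" and B: "C \<le> B" "2 * M / r \<le> B"
    using \<open>C \<ge> 0\<close> \<open>M \<ge> 0\<close> r by (auto simp: B_def add_nonneg_pos)
  have le: "f y - f x \<le> B * mdist G x y" if xy: "x \<in> mspace G" "y \<in> mspace G" for x y
  \<comment> \<open>The estimate with \<open>C\<close> is available only for \<open>h > 0\<close>,
    so equal points are treated apart from near ones.\<close>
  proof (cases "x = y \<or> mdist G x y > r")
    case False
    then have "0 < mdist G x y"
      using xy mdist_nonneg[of G x y] mdist_zero[OF xy] by linarith
    then have "f y - f x \<le> C * mdist G x y"
      using C[of "mdist G x y" x y] False xy by simp
    also have "\<dots> \<le> B * mdist G x y"
      using B by (simp add: mult_right_mono)
    finally show ?thesis .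
  next
    case True
    then show ?thesis
    proof
      assume far: "mdist G x y > r"
      have "f y - f x \<le> (2 * M / r) * r"
        using M[OF xy(1)] M[OF xy(2)] r by simp
      also have "\<dots> \<le> B * mdist G x y"
        using far B \<open>B > 0\<close> r by (intro mult_mono) auto
      finally show ?thesis .
    qed (use xy in simp)
  qed
  have "\<bar>f x - f y\<bar> \<le> B * mdist G x y" if "x \<in> mspace G" "y \<in> mspace G" for x y
    using le[OF that] le[OF that(2,1)] by (simp add: mdist_commute abs_le_iff)
  then show "f \<in> Lip_b G"
    using f \<open>B > 0\<close> by (auto simp: Lip_b_iff BUC_iff)
next
  fix f assume f: "f \<in> Lip_b G"
  then obtain B where "B > 0"
    and B: "\<And>x y. x \<in> mspace G \<Longrightarrow> y \<in> mspace G \<Longrightarrow> \<bar>f x - f y\<bar> \<le> B * mdist G x y"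
    by (auto simp: Lip_b_iff)
  have "f y - f x \<le> B * h" if "x \<in> mspace G" "y \<in> mspace G" "mdist G x y \<le> h" for x y h
    using B[OF that(1,2)] mult_left_mono[OF that(3), of B] \<open>B > 0\<close> by linarith
  then show "f \<in> Lipschitz_set G (uncertain_shift G)"
    unfolding mem_Lipschitz_set_uncertain_shift_iff
    \<comment> \<open>The estimate holds for every \<open>h\<close>, so the radius is arbitrary;
      \<open>zero_less_one\<close> supplies \<open>1\<close>.\<close>
    using f Lip_b_subset_BUC \<open>B > 0\<close> by (blast intro: less_imp_le zero_less_one)
qed

lemma symmetric_Lipschitz_set_uncertain_shift:
  "symmetric_Lipschitz_set G (uncertain_shift G) = Lip_b G"
  unfolding symmetric_Lipschitz_set_def Lipschitz_set_uncertain_shift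
  using Lip_b_subset_BUC Lip_b_uminus by auto

section \<open>Monotonicity and sublinearity\<close>

lemma monotone_semigroup_uncertain_shift: "monotone_semigroup G (uncertain_shift G)"
  unfolding monotone_semigroup_def monotone_operator_def
proof (intro allI ballI impI)
  fix t f g x
  assume t: "(0::real) \<le> t" and f: "f \<in> BUC G" and g: "g \<in> BUC G" and x: "x \<in> mspace G"
    and "\<forall>y\<in>mspace G. f y \<le> g y"
  then show "uncertain_shift G t f x \<le> uncertain_shift G t g x"
    unfolding uncertain_shift_le_iff[OF f x t]
    using uncertain_shift_upper[OF g x, of _ t] by force
qed

lemma sublinear_semigroup_uncertain_shift: "sublinear_semigroup G (uncertain_shift G)"
  unfolding sublinear_semigroup_def sublinear_operator_def
proof (intro allI impI conjI)
  fix t :: real assume t: "t \<ge> 0"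
  show "convex_operator G (uncertain_shift G t)"
    unfolding convex_operator_def
  proof (intro ballI)
    fix f g c x assume f: "f \<in> BUC G" and g: "g \<in> BUC G" and c: "c \<in> {0..1::real}" and x: "x \<in> mspace G"
    \<comment> \<open>\<open>cSUP_least\<close> asks only for a nonempty ball, so the convex
      combination need not be shown to lie in \<open>BUC G\<close> first.\<close>
    have "(SUP y\<in>{y \<in> mspace G. mdist G x y \<le> t}. (\<lambda>y\<in>mspace G. c * f y + (1 - c) * g y) y)
        \<le> c * uncertain_shift G t f x + (1 - c) * uncertain_shift G t g x"
    proof (rule cSUP_least)
      show "{y \<in> mspace G. mdist G x y \<le> t} \<noteq> {}"
        using x t by force
      fix y assume "y \<in> {y \<in> mspace G. mdist G x y \<le> t}"
      then show "(\<lambda>y\<in>mspace G. c * f y + (1 - c) * g y) y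
          \<le> c * uncertain_shift G t f x + (1 - c) * uncertain_shift G t g x"
        using uncertain_shift_upper[OF f x, of y t] uncertain_shift_upper[OF g x, of y t] c
        by (auto intro!: add_mono mult_left_mono)
    qed
    then show "uncertain_shift G t (\<lambda>y\<in>mspace G. c * f y + (1 - c) * g y) x
        \<le> c * uncertain_shift G t f x + (1 - c) * uncertain_shift G t g x"
      using x by (simp add: uncertain_shift_def)
  qed
  show "pos_homogeneous_operator G (uncertain_shift G t)"
    unfolding pos_homogeneous_operator_def
  proof (intro ballI allI impI ext)
    fix f c x assume f: "f \<in> BUC G" and c: "c > (0::real)"
    show "uncertain_shift G t (\<lambda>x\<in>mspace G. c * f x) x = (\<lambda>x\<in>mspace G. c * uncertain_shift G t f x) x"
    proof (cases "x \<in> mspace G")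
      case x: True
      \<comment> \<open>Since \<open>c > 0\<close>, \<open>a\<close> bounds \<open>c * f\<close> on
        the ball exactly when \<open>a / c\<close> bounds \<open>f\<close> there. Numbers with the
        same upper bounds are equal.\<close>
      have "uncertain_shift G t (\<lambda>x\<in>mspace G. c * f x) x \<le> a \<longleftrightarrow> c * uncertain_shift G t f x \<le> a" for a
        using uncertain_shift_le_iff[OF BUC_scale[OF f] x t, of c a]
          uncertain_shift_le_iff[OF f x t, of "a / c"] c
        by (simp add: field_simps)
      then have "uncertain_shift G t (\<lambda>x\<in>mspace G. c * f x) x = c * uncertain_shift G t f x"
        by (meson order.antisym order.refl)
      then show ?thesis
        using x by simp
    qed (simp add: uncertain_shift_def)
  qed
qed

section \<open>Consequences of intermediate points: invariance, semigroup law, strong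
  continuity\<close>

context
  fixes G :: "'a metric"
  assumes convex: "\<And>x y c. x \<in> mspace G \<Longrightarrow> y \<in> mspace G \<Longrightarrow> 0 < c \<Longrightarrow> c < 1 \<Longrightarrow>
      \<exists>z\<in>mspace G. mdist G x z = c * mdist G x y \<and> mdist G z y = (1 - c) * mdist G x y"
begin

lemma split_mdist:
  assumes x: "x \<in> mspace G" and y: "y \<in> mspace G" and s: "s \<ge> 0" and t: "t \<ge> 0"
    and xy: "mdist G x y \<le> t + s"
  obtains z where "z \<in> mspace G" "mdist G x z \<le> t" "mdist G z y \<le> s"
proof -
  \<comment> \<open>Intermediate points are given for ratios strictly between 0 and 1 only. The
    first two cases take an endpoint, \<open>y\<close> or \<open>x\<close>; the third takes the
    ratio \<open>t / mdist G x y\<close>, which puts \<open>z\<close> at distance exactly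
    \<open>t\<close> from \<open>x\<close>.\<close>
  consider "mdist G x y \<le> t" | "t = 0" | "0 < t" "t < mdist G x y"
    using t by linarith
  then show thesis
  proof cases
    case 1
    then show ?thesis
      using that[of y] y s by simp
  next
    case 2
    then show ?thesis
      using that[of x] x xy by simp
  next
    case 3
    then obtain z where "z \<in> mspace G" "mdist G x z = t / mdist G x y * mdist G x y"
      "mdist G z y = (1 - t / mdist G x y) * mdist G x y"
      using convex[OF x y, of "t / mdist G x y"] by auto
    then show ?thesis
      using that[of z] xy 3 by (auto simp: left_diff_distrib)
  qed
qed

text \<open>A point \<open>u\<close> of the ball around \<open>x\<close> has distance at most
  \<open>t + mdist G x y\<close> from \<open>y\<close>. Splitting that distance gives
  \<open>v\<close> in the ball around \<open>y\<close> with
  \<open>mdist G v u \<le> mdist G x y\<close>, so the uniform continuity of \<open>f\<close>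
  compares \<open>f u\<close> with \<open>f v\<close>.\<close>

lemma uncertain_shift_in_BUC:
  assumes f: "f \<in> BUC G" and t: "t \<ge> 0"
  shows "uncertain_shift G t f \<in> BUC G"
proof -
  obtain M where M: "\<And>x. x \<in> mspace G \<Longrightarrow> \<bar>f x\<bar> \<le> M"
    using BUC_bound[OF f] by metis
  have "\<exists>d>0. \<forall>x\<in>mspace G. \<forall>y\<in>mspace G. mdist G x y < d \<longrightarrow>
      \<bar>uncertain_shift G t f x - uncertain_shift G t f y\<bar> < e" if "e > 0" for e
  proof -
    \<comment> \<open>Passing to the supremum weakens \<open><\<close> to \<open>\<le>\<close>;
      halving \<open>e\<close> restores strictness.\<close>
    have "e / 2 > 0"
      using that by simp
    then obtain d where "d > 0"
      and d: "\<forall>x\<in>mspace G. \<forall>y\<in>mspace G. mdist G x y < d \<longrightarrow> \<bar>f x - f y\<bar> < e / 2"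
      using f by (auto simp only: BUC_iff)
    have le: "uncertain_shift G t f x \<le> uncertain_shift G t f y + e / 2"
      if x: "x \<in> mspace G" and y: "y \<in> mspace G" and xy: "mdist G x y < d" for x y
      unfolding uncertain_shift_le_iff[OF f x t]
    proof (intro ballI impI)
      fix u assume u: "u \<in> mspace G" "mdist G x u \<le> t"
      have "mdist G y u \<le> t + mdist G x y"
        using mdist_triangle[OF y x u(1)] u(2) by (simp add: mdist_commute)
      then obtain v where v: "v \<in> mspace G" "mdist G y v \<le> t" "mdist G v u \<le> mdist G x y"
        by (rule split_mdist[OF y u(1) mdist_nonneg t])
      have "f u \<le> f v + e / 2"
        using d[rule_format, OF v(1) u(1)] v(3) xy by linarith
      also have "f v \<le> uncertain_shift G t f y"
        using uncertain_shift_upper[OF f y v(1,2)] .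
      finally show "f u \<le> uncertain_shift G t f y + e / 2"
        by simp
    qed
    have "\<bar>uncertain_shift G t f x - uncertain_shift G t f y\<bar> < e"
      if "x \<in> mspace G" "y \<in> mspace G" "mdist G x y < d" for x y
      using le[OF that] le[OF that(2,1)] that(3) \<open>e > 0\<close> unfolding mdist_commute[of G y x]
      by linarith
    then show ?thesis
      using \<open>d > 0\<close> by blast
  qed
  moreover have "\<forall>x\<in>mspace G. \<bar>uncertain_shift G t f x\<bar> \<le> M"
    using uncertain_shift_abs_le[OF f _ t] M by blast
  ultimately show ?thesis
    by (auto simp: BUC_iff uncertain_shift_def)
qed

lemma uncertain_shift_add:
  assumes f: "f \<in> BUC G" and s: "s \<ge> 0" and t: "t \<ge> 0"
  shows "uncertain_shift G (t + s) f = uncertain_shift G t (uncertain_shift G s f)"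
proof
  fix x
  show "uncertain_shift G (t + s) f x = uncertain_shift G t (uncertain_shift G s f) x"
  proof (cases "x \<in> mspace G")
    case x: True
    have "uncertain_shift G t (uncertain_shift G s f) x \<le> a \<longleftrightarrow>
      (\<forall>z\<in>mspace G. mdist G x z \<le> t \<longrightarrow> (\<forall>y\<in>mspace G. mdist G z y \<le> s \<longrightarrow> f y \<le> a))" for a
      by (simp add: uncertain_shift_le_iff[OF uncertain_shift_in_BUC[OF f s] x t]
          uncertain_shift_le_iff[OF f _ s])
    \<comment> \<open>From left to right, \<open>split_mdist\<close> supplies the intermediate
      \<open>z\<close>; the converse is the triangle inequality.\<close>
    also have "(\<forall>z\<in>mspace G. mdist G x z \<le> t \<longrightarrow> (\<forall>y\<in>mspace G. mdist G z y \<le> s \<longrightarrow> f y \<le> a)) \<longleftrightarrow>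
      (\<forall>y\<in>mspace G. mdist G x y \<le> t + s \<longrightarrow> f y \<le> a)" for a
    proof safe
      fix y assume *: "\<forall>z\<in>mspace G. mdist G x z \<le> t \<longrightarrow> (\<forall>y\<in>mspace G. mdist G z y \<le> s \<longrightarrow> f y \<le> a)"
        and y: "y \<in> mspace G" "mdist G x y \<le> t + s"
      obtain z where "z \<in> mspace G" "mdist G x z \<le> t" "mdist G z y \<le> s"
        using split_mdist[OF x y(1) s t y(2)] .
      with * y show "f y \<le> a"
        by blast
    next
      fix z y assume *: "\<forall>y\<in>mspace G. mdist G x y \<le> t + s \<longrightarrow> f y \<le> a"
        and z: "z \<in> mspace G" "mdist G x z \<le> t" and y: "y \<in> mspace G" "mdist G z y \<le> s"
      have "mdist G x y \<le> t + s"
        using mdist_triangle[OF x z(1) y(1)] z y by linarith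
      with * y show "f y \<le> a"
        by blast
    qed
    also have "(\<forall>y\<in>mspace G. mdist G x y \<le> t + s \<longrightarrow> f y \<le> a) \<longleftrightarrow>
      uncertain_shift G (t + s) f x \<le> a" for a
      using uncertain_shift_le_iff[OF f x, of "t + s"] s t by simp
    finally show ?thesis
      by (meson order.eq_iff)
  qed (simp add: uncertain_shift_def)
qed

lemma C0_semigroup_uncertain_shift: "C0_semigroup G (uncertain_shift G)"
  unfolding C0_semigroup_def
proof (intro conjI ballI allI impI)
  fix t :: real assume t: "t \<ge> 0"
  have "(SUP f\<in>{f \<in> BUC G. sup_norm G f \<le> ennreal r}. sup_norm G (uncertain_shift G t f)) < \<infinity>"
    if "r > 0" for r
    \<comment> \<open>The shift does not increase norms, so \<open>r\<close> itself is the
      bound.\<close>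
    unfolding SUP_sup_norm_finite_iff
    using that uncertain_shift_abs_le[OF _ _ t] by (intro exI[of _ r]) (auto simp: sup_norm_le_iff)
  then show "bounded_operator G (uncertain_shift G t)"
    using uncertain_shift_in_BUC[OF _ t] by (auto simp: bounded_operator_def)
next
  fix f assume f: "f \<in> BUC G"
  have "uncertain_shift G 0 f x = f x" if "x \<in> mspace G" for x
  proof -
    have "mdist G x y \<le> 0 \<longleftrightarrow> x = y" if "y \<in> mspace G" for y
      using mdist_zero[OF \<open>x \<in> mspace G\<close> that] mdist_nonneg[of G x y] by linarith
    then have "{y \<in> mspace G. mdist G x y \<le> 0} = {x}"
      using that by auto
    then show ?thesis
      using that by (simp add: uncertain_shift_def)
  qed
  then show "uncertain_shift G 0 f = f"
    using f by (intro extensionalityI[of _ "mspace G"]) (auto simp: BUC_iff uncertain_shift_def)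
next
  fix f and s t :: real
  assume "f \<in> BUC G" "s \<ge> 0" "t \<ge> 0"
  then show "uncertain_shift G (t + s) f = uncertain_shift G t (uncertain_shift G s f)"
    by (rule uncertain_shift_add)
next
  fix f assume f: "f \<in> BUC G"
  show "((\<lambda>t. sup_norm G (\<lambda>x. uncertain_shift G t f x - f x)) \<longlongrightarrow> 0) (at_right 0)"
  proof (rule order_tendstoI)
    fix a :: ennreal assume "0 < a"
    \<comment> \<open>\<open>a\<close> may be infinite, whereas \<open>b < a\<close> is a real
      number. The gap also turns the bound \<open>\<le> b\<close> on the norm into
      \<open>< a\<close>.\<close>
    then obtain b where b: "0 < b" "b < a"
      using dense by blast
    then obtain e where "b = ennreal e" "e > 0"
      by (cases b) auto
    then obtain d where "d > 0"
      and d: "\<forall>x\<in>mspace G. \<forall>y\<in>mspace G. mdist G x y < d \<longrightarrow> \<bar>f x - f y\<bar> < e"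
      using f by (auto simp only: BUC_iff)
    have "sup_norm G (\<lambda>x. uncertain_shift G t f x - f x) < a" if t: "0 < t" "t < d" for t
    proof -
      have "f y - f x \<le> e" if "x \<in> mspace G" "y \<in> mspace G" "mdist G x y \<le> t" for x y
        using d[rule_format, OF that(1,2)] that(3) t by linarith
      then have "sup_norm G (\<lambda>x. uncertain_shift G t f x - f x) \<le> ennreal e"
        using f \<open>e > 0\<close> t by (simp add: sup_norm_le_iff uncertain_shift_diff_le_iff)
      then show ?thesis
        using b \<open>b = ennreal e\<close> by simp
    qed
    then show "\<forall>\<^sub>F t in at_right 0. sup_norm G (\<lambda>x. uncertain_shift G t f x - f x) < a"
      unfolding eventually_at_right_field using \<open>d > 0\<close> by blast
  \<comment> \<open>What remains is the lower half of the order criterion, which is vacuous as no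
    \<open>ennreal\<close> is below 0.\<close>
  qed simp
qed

end

theorem lemma5p1:
  fixes G :: "'a metric"
  assumes convex: "\<And>x y c. x \<in> mspace G \<Longrightarrow> y \<in> mspace G \<Longrightarrow> 0 < c \<Longrightarrow> c < 1 \<Longrightarrow>
      \<exists>z\<in>mspace G. mdist G x z = c * mdist G x y \<and> mdist G z y = (1 - c) * mdist G x y"
  shows "C0_semigroup G (uncertain_shift G) \<and>
         sublinear_semigroup G (uncertain_shift G) \<and>
         monotone_semigroup G (uncertain_shift G) \<and>
         Lipschitz_set G (uncertain_shift G) = symmetric_Lipschitz_set G (uncertain_shift G) \<and>
         symmetric_Lipschitz_set G (uncertain_shift G) = Lip_b G"
  using C0_semigroup_uncertain_shift[OF convex]
  by (simp add: sublinear_semigroup_uncertain_shift monotone_semigroup_uncertain_shift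
      Lipschitz_set_uncertain_shift symmetric_Lipschitz_set_uncertain_shift)

end
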